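(* Let $m,g,A,C,R,\mu>0$, $0<\epsilon<R$, $J\in\mathbb R$, and let $\theta_0\in[0,\pi]$ be a relative equilibrium of the reduced tippe top system with Jellet value $J$, i.e. $W'(\theta_0)=0$. The characteristic polynomial of the reduced equations linearized at $\theta_0$ is $p(\lambda)=\lambda\,q(\lambda)$ with $$q(\lambda)=\lambda^3+\mu mg\Big(\frac{(R-\epsilon\cos\theta_0)^2}{T_{\theta\theta}(\theta_0)}+\frac{\sin^2\theta_0}{T_{\bar\varphi\bar\varphi}(\theta_0)}\Big)\lambda^2+\Big(\frac{(\mu mg(R-\epsilon\cos\theta_0)\sin\theta_0)^2+\tau'(\theta_0)^2}{T_{\theta\theta}(\theta_0)T_{\bar\varphi\bar\varphi}(\theta_0)}+\frac{W''(\theta_0)}{T_{\theta\theta}(\theta_0)}\Big)\lambda+\frac{\mu mg\sin^2\theta_0\,W''(\theta_0)}{T_{\theta\theta}(\theta_0)T_{\bar\varphi\bar\varphi}(\theta_0)}$$ (for $\sin\theta_0=0$ the coefficients are understood as their continuous extensions in $\theta_0$). All three roots of $q$ have negative real part if and only if $W''(\theta_0)>0$.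
   Context: Put $D(\theta)=R^2A\sin^2\theta+C(R\cos\theta-\epsilon)^2$, $T_{\theta\theta}(\theta)=\epsilon^2m\sin^2\theta+A$, $T_{\bar\varphi\bar\varphi}(\theta)=AC\sin^2\theta/D(\theta)$, $$\tau(\theta)=\frac{J}{R^2+\epsilon^2}\,\frac{R\epsilon A\sin^2\theta+C(R+\epsilon\cos\theta)(R\cos\theta-\epsilon)}{D(\theta)},\qquad W(\theta)=\frac{J^2}{2D(\theta)}-mg\epsilon\cos\theta.$$ The reduced tippe top system in the variables $(\theta,\bar\varphi)$ consists of the Lagrange equations for $\mathcal R=\frac12T_{\theta\theta}(\theta)\dot\theta^2+\frac12T_{\bar\varphi\bar\varphi}(\theta)\dot{\bar\varphi}^2+\tau(\theta)\dot{\bar\varphi}-W(\theta)$ with generalized forces $Q'_\theta=-\mu R_n'(R-\epsilon\cos\theta)^2\dot\theta$ and $Q'_{\bar\varphi}=-\mu R_n'\sin^2\theta\,\dot{\bar\varphi}$. Here $R_n'$ is a function of $(\theta,\dot\theta,\dot{\bar\varphi})$ (the normal reaction) whose value at every relative equilibrium ($\dot\theta=\dot{\bar\varphi}=0$, $W'(\theta)=0$) is $mg$. The linearized equations at $\theta_0$ are $$T_{\theta\theta}(\theta_0)\ddot\theta=\tau'(\theta_0)\dot{\bar\varphi}-W''(\theta_0)(\theta-\theta_0)-\mu mg(R-\epsilon\cos\theta_0)^2\dot\theta,$$ $$T_{\bar\varphi\bar\varphi}(\theta_0)\ddot{\bar\varphi}=-\tau'(\theta_0)\dot\theta-\mu mg\sin^2\theta_0\,\dot{\bar\varphi}.$$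 *)

theory Defs
  imports "HOL-Analysis.Analysis" "Jordan_Normal_Form.Char_Poly"
begin

definition tt_D :: "real \<Rightarrow> real \<Rightarrow> real \<Rightarrow> real \<Rightarrow> real \<Rightarrow> real" where
  "tt_D A C R \<epsilon> \<theta> = R^2 * A * (sin \<theta>)^2 + C * (R * cos \<theta> - \<epsilon>)^2"

definition tt_T_theta :: "real \<Rightarrow> real \<Rightarrow> real \<Rightarrow> real \<Rightarrow> real" where
  "tt_T_theta m A \<epsilon> \<theta> = \<epsilon>^2 * m * (sin \<theta>)^2 + A"

definition tt_T_phi :: "real \<Rightarrow> real \<Rightarrow> real \<Rightarrow> real \<Rightarrow> real \<Rightarrow> real" where
  "tt_T_phi A C R \<epsilon> \<theta> = A * C * (sin \<theta>)^2 / tt_D A C R \<epsilon> \<theta>"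

definition tt_tau :: "real \<Rightarrow> real \<Rightarrow> real \<Rightarrow> real \<Rightarrow> real \<Rightarrow> real \<Rightarrow> real" where
  "tt_tau A C R \<epsilon> J \<theta> =
     J / (R^2 + \<epsilon>^2) *
     ((R * \<epsilon> * A * (sin \<theta>)^2 + C * (R + \<epsilon> * cos \<theta>) * (R * cos \<theta> - \<epsilon>)) / tt_D A C R \<epsilon> \<theta>)"

definition tt_W :: "real \<Rightarrow> real \<Rightarrow> real \<Rightarrow> real \<Rightarrow> real \<Rightarrow> real \<Rightarrow> real \<Rightarrow> real \<Rightarrow> real" where
  "tt_W m g A C R \<epsilon> J \<theta> = J^2 / (2 * tt_D A C R \<epsilon> \<theta>) - m * g * \<epsilon> * cos \<theta>"

text \<open>The reduced Lagrangian; \<open>v\<close> and \<open>w\<close> are the velocities of \<open>\<theta>\<close> and of the cyclic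
  coordinate \<open>\<phi>\<close>.\<close>

definition tt_lagrangian ::
  "real \<Rightarrow> real \<Rightarrow> real \<Rightarrow> real \<Rightarrow> real \<Rightarrow> real \<Rightarrow> real \<Rightarrow> real \<Rightarrow> real \<Rightarrow> real \<Rightarrow> real" where
  "tt_lagrangian m g A C R \<epsilon> J \<theta> v w =
     1/2 * tt_T_theta m A \<epsilon> \<theta> * v^2 + 1/2 * tt_T_phi A C R \<epsilon> \<theta> * w^2
     + tt_tau A C R \<epsilon> J \<theta> * w - tt_W m g A C R \<epsilon> J \<theta>"

text \<open>Euler-Lagrange expressions of a Lagrangian \<open>L \<theta> v w\<close> that does not depend on \<open>\<phi>\<close>, as functions
  of \<open>\<theta>\<close>, the velocities \<open>v, w\<close> and the accelerations \<open>a, b\<close>. The outer derivative at \<open>s = 0\<close> is the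
  total time derivative of the momentum: by the chain rule it depends on a curve only through its
  position, velocity and acceleration, so it is taken along \<open>(\<theta> + s v, v + s a, w + s b)\<close>.\<close>

definition EL_theta ::
  "(real \<Rightarrow> real \<Rightarrow> real \<Rightarrow> real) \<Rightarrow> real \<Rightarrow> real \<Rightarrow> real \<Rightarrow> real \<Rightarrow> real \<Rightarrow> real" where
  "EL_theta L \<theta> v w a b =
     deriv (\<lambda>s. deriv (\<lambda>u. L (\<theta> + s * v) u (w + s * b)) (v + s * a)) 0
     - deriv (\<lambda>x. L x v w) \<theta>"

definition EL_phi ::
  "(real \<Rightarrow> real \<Rightarrow> real \<Rightarrow> real) \<Rightarrow> real \<Rightarrow> real \<Rightarrow> real \<Rightarrow> real \<Rightarrow> real \<Rightarrow> real" where
  "EL_phi L \<theta> v w a b =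
     deriv (\<lambda>s. deriv (\<lambda>u. L (\<theta> + s * v) (v + s * a) u) (w + s * b)) 0"

text \<open>Left minus right sides of the two reduced equations, with friction forces built from the
  normal reaction \<open>Rn\<close>; the reduced equations state that both vanish.\<close>

definition tt_reduced_theta where
  "tt_reduced_theta m g A C R \<epsilon> \<mu> J (Rn :: real \<Rightarrow> real \<Rightarrow> real \<Rightarrow> real) \<theta> v w a b =
     EL_theta (tt_lagrangian m g A C R \<epsilon> J) \<theta> v w a b
     - (- \<mu> * Rn \<theta> v w * (R - \<epsilon> * cos \<theta>)^2 * v)"

definition tt_reduced_phi where
  "tt_reduced_phi m g A C R \<epsilon> \<mu> J (Rn :: real \<Rightarrow> real \<Rightarrow> real \<Rightarrow> real) \<theta> v w a b =
     EL_phi (tt_lagrangian m g A C R \<epsilon> J) \<theta> v w a b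
     - (- \<mu> * Rn \<theta> v w * (sin \<theta>)^2 * w)"

text \<open>Left minus right sides of the linearized equations at \<open>\<theta>\<close>; \<open>x\<close> is the displacement of the
  angle from \<open>\<theta>\<close>.\<close>

definition tt_linear_theta ::
  "real \<Rightarrow> real \<Rightarrow> real \<Rightarrow> real \<Rightarrow> real \<Rightarrow> real \<Rightarrow> real \<Rightarrow> real \<Rightarrow> real \<Rightarrow>
   real \<Rightarrow> real \<Rightarrow> real \<Rightarrow> real \<Rightarrow> real" where
  "tt_linear_theta m g A C R \<epsilon> \<mu> J \<theta> x v w a =
     tt_T_theta m A \<epsilon> \<theta> * a
     - (deriv (tt_tau A C R \<epsilon> J) \<theta> * w - deriv (deriv (tt_W m g A C R \<epsilon> J)) \<theta> * x
        - \<mu> * m * g * (R - \<epsilon> * cos \<theta>)^2 * v)"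

definition tt_linear_phi ::
  "real \<Rightarrow> real \<Rightarrow> real \<Rightarrow> real \<Rightarrow> real \<Rightarrow> real \<Rightarrow> real \<Rightarrow> real \<Rightarrow> real \<Rightarrow>
   real \<Rightarrow> real \<Rightarrow> real \<Rightarrow> real" where
  "tt_linear_phi m g A C R \<epsilon> \<mu> J \<theta> v w b =
     tt_T_phi A C R \<epsilon> \<theta> * b
     - (- deriv (tt_tau A C R \<epsilon> J) \<theta> * v - \<mu> * m * g * (sin \<theta>)^2 * w)"

text \<open>The linearized equations solved for \<open>a\<close> and \<open>b\<close>, as a first-order system in \<open>(x, \<phi>, v, w)\<close>.
  This needs \<open>sin \<theta> \<noteq> 0\<close>; otherwise \<open>tt_T_phi\<close> vanishes and the last row is meaningless.\<close>

definition tt_matrix ::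
  "real \<Rightarrow> real \<Rightarrow> real \<Rightarrow> real \<Rightarrow> real \<Rightarrow> real \<Rightarrow> real \<Rightarrow> real \<Rightarrow> real \<Rightarrow> real mat" where
  "tt_matrix m g A C R \<epsilon> \<mu> J \<theta> =
    (let Tth = tt_T_theta m A \<epsilon> \<theta>;
         Tph = tt_T_phi A C R \<epsilon> \<theta>;
         dtau = deriv (tt_tau A C R \<epsilon> J) \<theta>;
         ddW = deriv (deriv (tt_W m g A C R \<epsilon> J)) \<theta>
     in mat_of_rows_list 4
       [[0, 0, 1, 0],
        [0, 0, 0, 1],
        [- ddW / Tth, 0, - (\<mu> * m * g * (R - \<epsilon> * cos \<theta>)^2) / Tth, dtau / Tth],
        [0, 0, - dtau / Tph, - (\<mu> * m * g * (sin \<theta>)^2) / Tph]])"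

text \<open>Coefficients of \<open>q\<close> (of \<open>\<lambda>^2\<close>, \<open>\<lambda>\<close> and \<open>1\<close>), valid as they stand for \<open>sin \<theta> \<noteq> 0\<close>.\<close>

definition tt_c2 ::
  "real \<Rightarrow> real \<Rightarrow> real \<Rightarrow> real \<Rightarrow> real \<Rightarrow> real \<Rightarrow> real \<Rightarrow> real \<Rightarrow> real" where
  "tt_c2 m g A C R \<epsilon> \<mu> \<theta> =
     \<mu> * m * g * ((R - \<epsilon> * cos \<theta>)^2 / tt_T_theta m A \<epsilon> \<theta>
                  + (sin \<theta>)^2 / tt_T_phi A C R \<epsilon> \<theta>)"

definition tt_c1 ::
  "real \<Rightarrow> real \<Rightarrow> real \<Rightarrow> real \<Rightarrow> real \<Rightarrow> real \<Rightarrow> real \<Rightarrow> real \<Rightarrow> real \<Rightarrow> real" where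
  "tt_c1 m g A C R \<epsilon> \<mu> J \<theta> =
     ((\<mu> * m * g * (R - \<epsilon> * cos \<theta>) * sin \<theta>)^2 + (deriv (tt_tau A C R \<epsilon> J) \<theta>)^2)
       / (tt_T_theta m A \<epsilon> \<theta> * tt_T_phi A C R \<epsilon> \<theta>)
     + deriv (deriv (tt_W m g A C R \<epsilon> J)) \<theta> / tt_T_theta m A \<epsilon> \<theta>"

definition tt_c0 ::
  "real \<Rightarrow> real \<Rightarrow> real \<Rightarrow> real \<Rightarrow> real \<Rightarrow> real \<Rightarrow> real \<Rightarrow> real \<Rightarrow> real \<Rightarrow> real" where
  "tt_c0 m g A C R \<epsilon> \<mu> J \<theta> =
     \<mu> * m * g * (sin \<theta>)^2 * deriv (deriv (tt_W m g A C R \<epsilon> J)) \<theta>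
       / (tt_T_theta m A \<epsilon> \<theta> * tt_T_phi A C R \<epsilon> \<theta>)"

definition pole_ext :: "(real \<Rightarrow> real) \<Rightarrow> real \<Rightarrow> real" where
  "pole_ext f \<theta> = (if sin \<theta> = 0 then Lim (at \<theta>) f else f \<theta>)"

definition tt_q ::
  "real \<Rightarrow> real \<Rightarrow> real \<Rightarrow> real \<Rightarrow> real \<Rightarrow> real \<Rightarrow> real \<Rightarrow> real \<Rightarrow> real \<Rightarrow> real poly" where
  "tt_q m g A C R \<epsilon> \<mu> J \<theta> =
     [: pole_ext (tt_c0 m g A C R \<epsilon> \<mu> J) \<theta>,
        pole_ext (tt_c1 m g A C R \<epsilon> \<mu> J) \<theta>,
        pole_ext (tt_c2 m g A C R \<epsilon> \<mu>) \<theta>,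
        1 :]"

end

theory Submission
  imports Defs
begin

text \<open>
  The only terms of the reduced equations that survive linearization at an equilibrium are those
  with one factor vanishing to first order, so for each of them except \<open>W'\<close> the continuity of
  the other factor suffices.

  Since \<open>D > 0\<close> everywhere, and since \<open>\<tau>'\<close> is \<open>sin \<theta>\<close> times a continuous function, the factor
  \<open>sin\<^sup>2 \<theta>\<close> in \<open>T\<^sub>\<phi>\<close> cancels from all coefficients of \<open>q\<close>, which gives their extensions to the
  poles. These extensions have the form \<open>e w\<close>, \<open>s + w\<close>, \<open>d + e\<close> with \<open>d, e, s > 0\<close> and
  \<open>w = W'' / T\<^sub>\<theta>\<close>. If \<open>w > 0\<close> the Routh-Hurwitz inequality holds because
  \<open>(d + e) (s + w) - e w = (d + e) s + d w\<close>; if \<open>w \<le> 0\<close> then \<open>q 0 \<le> 0\<close>, so \<open>q\<close> has a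
  nonnegative real root.
\<close>

section \<open>Characteristic polynomial of the first-order system\<close>

lemma det_3:
  fixes A :: "'a :: comm_ring_1 mat"
  assumes "A \<in> carrier_mat 3 3"
  shows "Determinant.det A =
    A $$ (0,0) * (A $$ (1,1) * A $$ (2,2) - A $$ (1,2) * A $$ (2,1))
    - A $$ (0,1) * (A $$ (1,0) * A $$ (2,2) - A $$ (1,2) * A $$ (2,0))
    + A $$ (0,2) * (A $$ (1,0) * A $$ (2,1) - A $$ (1,1) * A $$ (2,0))"
proof -
  have det_2: "Determinant.det B = B $$ (0,0) * B $$ (1,1) - B $$ (0,1) * B $$ (1,0)"
    if B: "B \<in> carrier_mat 2 2" for B :: "'a mat"
    using B laplace_expansion_column[OF B, of 0]
    by (simp add: numeral_eq_Suc lessThan_Suc Determinant.cofactor_def det_single mat_delete_def)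
  show ?thesis
    using assms laplace_expansion_column[OF assms, of 0]
    by (simp add: numeral_3_eq_3 numeral_2_eq_2 lessThan_Suc Determinant.cofactor_def det_2
        mat_delete_def algebra_simps)
qed

text \<open>The second column of the matrix is zero because the coordinate \<open>\<phi>\<close> is
  cyclic. Expanding the characteristic matrix along it splits off the factor \<open>[:0, 1:]\<close>
  and leaves a 3 by 3 determinant.\<close>

lemma char_poly_4:
  fixes a b c d e :: "'a :: comm_ring_1"
  shows "char_poly (mat_of_rows_list 4 [[0,0,1,0],[0,0,0,1],[a,0,b,c],[0,0,d,e]]) =
    [:0, 1:] * [:a * e, b * e - c * d - a, - b - e, 1:]"
proof -
  define rows where "rows = [[0,0,1,0],[0,0,0,1],[a,0,b,c],[0,0,d,e]]"
  define P where "P = char_poly_matrix (mat_of_rows_list 4 rows)"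
  have P: "P \<in> carrier_mat 4 4"
    unfolding P_def by (intro char_poly_matrix_closed carrier_matI)
      (simp_all add: rows_def mat_of_rows_list_def)
  have entry: "P $$ (i,j) = (if i = j then [:0, 1:] else 0) - [:rows ! i ! j:]" if "i < 4" "j < 4" for i j
    using that by (auto simp: P_def rows_def char_poly_matrix_def mat_of_rows_list_def)
  have delete: "mat_delete P 1 1 \<in> carrier_mat 3 3"
    using P by (auto simp: mat_delete_def)
  have "Determinant.det P = [:0, 1:] * Determinant.det (mat_delete P 1 1)"
    using laplace_expansion_column[OF P, of 1]
    by (simp add: numeral_eq_Suc lessThan_Suc entry rows_def Determinant.cofactor_def)
  also have "Determinant.det (mat_delete P 1 1) = [:a * e, b * e - c * d - a, - b - e, 1:]"
    unfolding det_3[OF delete] using P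
    by (simp add: mat_delete_def entry rows_def numeral_eq_Suc)
  finally show ?thesis by (simp add: char_poly_def P_def rows_def)
qed

section \<open>Location of the roots of real cubics\<close>

lemma routh_hurwitz_cubic:
  fixes a0 a1 a2 :: real
  assumes "a0 > 0" "a1 > 0" "a2 > 0" "a2 * a1 > a0" 
    and z: "poly (map_poly complex_of_real [:a0, a1, a2, 1:]) z = 0"
  shows "Re z < 0"
proof (rule ccontr)
  assume "\<not> Re z < 0"
  then have x: "Re z \<ge> 0" by simp
  define x y where "x = Re z" and "y = Im z"
  have zz: "z = Complex x y" by (simp add: x_def y_def)
  have x: "x \<ge> 0" using x x_def by simp
  have re: "x^3 - 3*x*y^2 + a2*(x^2 - y^2) + a1*x + a0 = 0"
    and im: "y * (3*x^2 - y^2 + 2*a2*x + a1) = 0"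
    using z by (simp_all add: zz complex_eq_iff map_poly_pCons power2_eq_square power3_eq_cube algebra_simps)
  show False
  proof (cases "y = 0")
    case True
    have "x^3 + a2*x^2 + a1*x + a0 > 0"
      using x assms by (intro add_nonneg_pos add_nonneg_nonneg) auto
    then show False using re True by simp
  next
    case False
    \<comment> \<open>For a non-real root the imaginary part determines \<open>y^2\<close>.
      Substituting this into the real part eliminates \<open>y\<close> and leaves a cubic in
      \<open>x\<close> whose constant term is the Hurwitz determinant \<open>a2*a1 - a0\<close>, up
      to a common sign.\<close>
    then have y2: "y^2 = 3*x^2 + 2*a2*x + a1" using im by auto
    have "8*x^3 + 8*a2*x^2 + 2*(a1 + a2^2)*x + (a2*a1 - a0) = 0"
      using re unfolding y2 by (simp add: algebra_simps power2_eq_square power3_eq_cube)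
    moreover have "8*x^3 + 8*a2*x^2 + 2*(a1 + a2^2)*x + (a2*a1 - a0) > 0"
      using x assms by (intro add_nonneg_pos add_nonneg_nonneg) auto
    ultimately show False by simp
  qed
qed

lemma cubic_nonneg_root:
  fixes a0 a1 a2 :: real
  assumes "a0 \<le> 0"
  shows "\<exists>x\<ge>0. poly [:a0, a1, a2, 1:] x = 0"
proof -
  \<comment> \<open>\<open>b\<close> is an upper endpoint for the intermediate value theorem, with
    \<open>a0\<close> being the value at 0. The numbers \<open>u\<close> and \<open>v\<close> are
    the Horner stages at \<open>b\<close>; since \<open>b\<close> is at least 1 and exceeds the sum
    of the absolute values, each stage dominates the coefficients still to be added.\<close>
  obtain b where b: "b = 1 + \<bar>a0\<bar> + \<bar>a1\<bar> + \<bar>a2\<bar>" by simp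
  then have b1: "b \<ge> 1" by simp
  define u where "u = a2 + b"
  define v where "v = a1 + b * u"
  have u: "1 + \<bar>a0\<bar> + \<bar>a1\<bar> \<le> u" using b u_def by linarith
  then have "u \<le> b * u" using b1 by (simp add: mult_le_cancel_right1)
  then have v: "1 + \<bar>a0\<bar> \<le> v" using u v_def by linarith
  then have "v \<le> b * v" using b1 by (simp add: mult_le_cancel_right1)
  then have "0 \<le> a0 + b * v" using v by linarith
  then have "0 \<le> poly [:a0, a1, a2, 1:] b" by (simp add: u_def v_def)
  then have "\<exists>x\<ge>0. x \<le> b \<and> poly [:a0, a1, a2, 1:] x = 0"
    using assms b1 by (intro IVT) auto
  then show ?thesis by blast
qed

section \<open>Continuous extension to the zeros of the sine\<close>

lemma eventually_sin_nonzero: "\<forall>\<^sub>F x in at t. sin x \<noteq> (0::real)"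
proof (cases "sin t = 0")
  case True
  have "sin x \<noteq> 0" if "x \<noteq> t" "dist x t < pi" for x
  proof -
    have "sin (x - t) \<noteq> 0"
      using that sin_gt_zero[of "x - t"] sin_gt_zero[of "t - x"] sin_minus[of "x - t"]
      by (cases "x > t") (auto simp: dist_real_def)
    moreover have "sin (x - t) = sin x * cos t" using True by (simp add: sin_diff)
    ultimately show ?thesis by auto
  qed
  then show ?thesis unfolding eventually_at by (intro exI[of _ pi]) auto
next
  case False
  have "(sin \<longlongrightarrow> sin t) (at t)" by (intro tendsto_sin tendsto_ident_at)
  then show ?thesis by (rule tendsto_imp_eventually_ne) (rule False)
qed

text \<open>Limits see only a punctured neighbourhood, where the sine is nonzero. So a formula
  \<open>F\<close> that agrees with \<open>f\<close> there and is continuous at \<open>t\<close>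
  gives the extension, whatever value division by zero assigns to \<open>f t\<close>.\<close>

lemma pole_ext_eq:
  assumes F: "isCont F t" and eq: "\<And>x. sin x \<noteq> 0 \<Longrightarrow> f x = F x"
  shows "pole_ext f t = F t" and "(f \<longlongrightarrow> pole_ext f t) (at t)"
proof -
  have "\<forall>\<^sub>F x in at t. F x = f x"
    using eventually_sin_nonzero[of t] by eventually_elim (simp add: eq)
  then have lim: "(f \<longlongrightarrow> F t) (at t)"
    using F unfolding isCont_def by (rule Lim_transform_eventually[rotated])
  then show *: "pole_ext f t = F t"
    by (auto simp: pole_ext_def eq intro!: tendsto_Lim)
  show "(f \<longlongrightarrow> pole_ext f t) (at t)" using lim * by simp
qed

section \<open>Euler-Lagrange expressions and their linearization\<close>

text \<open>In the product rule the term with the derivative of \<open>f\<close> carries the factor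
  \<open>k p = 0\<close>, so continuity of \<open>f\<close> is enough. This matters for the normal
  reaction, which is only assumed continuous.\<close>

lemma has_derivative_mult_zero:
  fixes f k :: "'a::real_normed_vector \<Rightarrow> real"
  assumes f: "isCont f p" and k: "(k has_derivative k') (at p)" and "k p = 0"
  shows "((\<lambda>x. f x * k x) has_derivative (\<lambda>h. f p * k' h)) (at p)"
proof -
  have bl: "bounded_linear k'" using k by (rule has_derivative_bounded_linear)
  then obtain B where B: "\<And>h. norm (k' h) \<le> norm h * B" by (blast dest: bounded_linear.bounded)
  \<comment> \<open>The remainder quotient of the product is \<open>f y * ?r y + ?q y\<close>. The
    first summand tends to 0 by differentiability of \<open>k\<close>, the second by continuity of
    \<open>f\<close> and boundedness of \<open>k'\<close>.\<close>
  let ?r = "\<lambda>y. (k y - k p - k' (y - p)) /\<^sub>R norm (y - p)"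
  let ?q = "\<lambda>y. (f y - f p) * (k' (y - p) / norm (y - p))"
  have f0: "((\<lambda>y. f y - f p) \<longlongrightarrow> 0) (at p)"
    using f by (simp add: isCont_def LIM_zero_iff)
  have "(?q \<longlongrightarrow> 0) (at p)"
  proof (rule Lim_null_comparison)
    show "((\<lambda>y. norm (f y - f p) * B) \<longlongrightarrow> 0) (at p)"
      by (intro tendsto_mult_left_zero tendsto_norm_zero f0)
    show "\<forall>\<^sub>F y in at p. norm (?q y) \<le> norm (f y - f p) * B"
    proof (rule eventually_mono[OF eventually_neq_at_within[of p p UNIV]])
      fix y assume "y \<noteq> p"
      then have "norm (k' (y - p) / norm (y - p)) \<le> B"
        using B[of "y - p"] by (simp add: divide_le_eq mult.commute)
      then show "norm (?q y) \<le> norm (f y - f p) * B"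
        unfolding norm_mult by (rule mult_left_mono) simp
    qed
  qed
  moreover have "((\<lambda>y. f y * ?r y) \<longlongrightarrow> f p * 0) (at p)"
    using f k by (intro tendsto_mult) (auto simp: isCont_def has_derivative_at_within)
  ultimately have "((\<lambda>y. f y * ?r y + ?q y) \<longlongrightarrow> f p * 0 + 0) (at p)"
    by (intro tendsto_add)
  then have "((\<lambda>y. (f y * k y - f p * k p - f p * k' (y - p)) /\<^sub>R norm (y - p)) \<longlongrightarrow> 0) (at p)"
    using \<open>k p = 0\<close> by (simp add: algebra_simps divide_inverse)
  then show ?thesis
    using bounded_linear_const_mult[OF bl] by (simp add: has_derivative_at_within)
qed

text \<open>The time derivative of the momentum gives \<open>T' \<theta> * v^2\<close>, of which the
  position derivative removes half. The terms in \<open>\<tau>'\<close> enter the two equations with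
  opposite signs: they form the gyroscopic coupling, which is why \<open>\<tau>'\<close> appears
  squared with a plus sign in \<open>q\<close>.\<close>

lemma EL_quadratic:
  fixes T P \<tau> W T' P' \<tau>' W' :: "real \<Rightarrow> real"
  assumes T: "\<And>x. (T has_real_derivative T' x) (at x)"
    and P: "\<And>x. (P has_real_derivative P' x) (at x)"
    and \<tau>: "\<And>x. (\<tau> has_real_derivative \<tau>' x) (at x)"
    and W: "\<And>x. (W has_real_derivative W' x) (at x)"
  defines "L \<equiv> \<lambda>\<theta> v w. 1/2 * T \<theta> * v^2 + 1/2 * P \<theta> * w^2 + \<tau> \<theta> * w - W \<theta>"
  shows "EL_theta L \<theta> v w a b =
      T \<theta> * a + 1/2 * T' \<theta> * v^2 - 1/2 * P' \<theta> * w^2 - \<tau>' \<theta> * w + W' \<theta>"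
    and "EL_phi L \<theta> v w a b = P \<theta> * b + P' \<theta> * (v * w) + \<tau>' \<theta> * v"
proof -
  note chain = DERIV_chain2[OF T] DERIV_chain2[OF P] DERIV_chain2[OF \<tau>] DERIV_chain2[OF W]
  \<comment> \<open>\<open>1\<close> and \<open>2\<close> compute the momenta conjugate to
    \<open>\<theta>\<close> and \<open>\<phi>\<close>; \<open>3\<close> and \<open>4\<close> are
    their time derivatives.\<close>
  have 1: "deriv (\<lambda>u. L x u y) z = T x * z" for x y z
    unfolding L_def by (rule DERIV_imp_deriv) (auto intro!: derivative_eq_intros)
  have 2: "deriv (\<lambda>u. L x y u) z = P x * z + \<tau> x" for x y z
    unfolding L_def by (rule DERIV_imp_deriv) (auto intro!: derivative_eq_intros)
  have 3: "deriv (\<lambda>s. T (\<theta> + s * v) * (v + s * a)) 0 = T \<theta> * a + T' \<theta> * v^2"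
    by (rule DERIV_imp_deriv)
      (auto intro!: derivative_eq_intros chain simp: power2_eq_square)
  have 4: "deriv (\<lambda>s. P (\<theta> + s * v) * (w + s * b) + \<tau> (\<theta> + s * v)) 0 = P \<theta> * b + P' \<theta> * (v * w) + \<tau>' \<theta> * v"
    by (rule DERIV_imp_deriv) (auto intro!: derivative_eq_intros chain)
  have 5: "deriv (\<lambda>x. L x v w) \<theta> = 1/2 * T' \<theta> * v^2 + 1/2 * P' \<theta> * w^2 + \<tau>' \<theta> * w - W' \<theta>"
    unfolding L_def
    by (rule DERIV_imp_deriv) (auto intro!: derivative_eq_intros T P \<tau> W)
  show "EL_theta L \<theta> v w a b =
      T \<theta> * a + 1/2 * T' \<theta> * v^2 - 1/2 * P' \<theta> * w^2 - \<tau>' \<theta> * w + W' \<theta>"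
    unfolding EL_theta_def 1 3 5 by simp
  show "EL_phi L \<theta> v w a b = P \<theta> * b + P' \<theta> * (v * w) + \<tau>' \<theta> * v"
    unfolding EL_phi_def 2 4 ..
qed

lemma isCont_of_fst: "isCont f (fst p) \<Longrightarrow> isCont (\<lambda>p. f (fst p)) p"
  by (rule isCont_o2[OF isCont_fst]) auto

text \<open>Continuity of the normal reaction is given in position and velocities, whereas the
  linearization takes place in the space that also contains the accelerations.\<close>

lemma isCont_of_first_three:
  assumes "isCont (\<lambda>(x, y, z). f x y z) (fst p, fst (snd p), fst (snd (snd p)))"
  shows "isCont (\<lambda>p. f (fst p) (fst (snd p)) (fst (snd (snd p)))) p"
  using isCont_o2[where g = "\<lambda>(x, y, z). f x y z"
      and f = "\<lambda>p. (fst p, fst (snd p), fst (snd (snd p)))" and a = p] assms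
  by (simp add: continuous_intros)

lemma linearization_theta:
  fixes T T' P' \<tau>' W' G :: "real \<Rightarrow> real"
  assumes "isCont T t" "isCont T' t" "isCont P' t" "isCont \<tau>' t"
    and W': "(W' has_real_derivative W2) (at t)"
    and G: "isCont G t" and Rn: "isCont (\<lambda>(\<theta>, v, w). Rn \<theta> v w) (t, 0, 0)"
  shows "((\<lambda>(\<theta>, v, w, a, b :: real). T \<theta> * a + 1/2 * T' \<theta> * v^2 - 1/2 * P' \<theta> * w^2 - \<tau>' \<theta> * w + W' \<theta>
        + Rn \<theta> v w * G \<theta> * v)
      has_derivative (\<lambda>(x, v, w, a, b). T t * a - \<tau>' t * w + W2 * x + Rn t 0 0 * G t * v))
      (at (t, 0, 0, 0, 0))"
proof -
  have W: "((\<lambda>p :: real \<times> real \<times> real \<times> real \<times> real. W' (fst p)) has_derivative (\<lambda>h. fst h * W2))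
      (at (t, 0, 0, 0, 0))"
    by (rule DERIV_compose_FDERIV[where g = fst]) (use W' in \<open>auto intro!: derivative_intros\<close>)
  note mult = has_derivative_mult_zero[where p = "(t, 0, 0, 0, 0) :: real \<times> real \<times> real \<times> real \<times> real"]
  \<comment> \<open>Tuples are written with projections so that each summand other than
    \<open>W'\<close> matches the product lemma. The two factors 0 are the derivatives of
    \<open>v^2\<close> and \<open>w^2\<close> at rest.\<close>
  have "((\<lambda>p. T (fst p) * fst (snd (snd (snd p))) + 1/2 * T' (fst p) * (fst (snd p))^2
        - 1/2 * P' (fst p) * (fst (snd (snd p)))^2 - \<tau>' (fst p) * fst (snd (snd p)) + W' (fst p)
        + Rn (fst p) (fst (snd p)) (fst (snd (snd p))) * G (fst p) * fst (snd p))
      has_derivative (\<lambda>h. T t * fst (snd (snd (snd h))) + 1/2 * T' t * 0 - 1/2 * P' t * 0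
        - \<tau>' t * fst (snd (snd h)) + fst h * W2 + Rn t 0 0 * G t * fst (snd h)))
      (at (t, 0, 0, 0, 0 :: real))"
    using assms
    by (intro has_derivative_add has_derivative_diff W
        mult[where f = "\<lambda>p. T (fst p)", simplified]
        mult[where f = "\<lambda>p. 1/2 * T' (fst p)", simplified fst_conv]
        mult[where f = "\<lambda>p. 1/2 * P' (fst p)", simplified fst_conv]
        mult[where f = "\<lambda>p. \<tau>' (fst p)", simplified fst_conv]
        mult[where f = "\<lambda>p. Rn (fst p) (fst (snd p)) (fst (snd (snd p))) * G (fst p)", simplified fst_conv snd_conv]
        continuous_intros isCont_of_fst isCont_of_first_three)
      (auto intro!: derivative_eq_intros)
  then show ?thesis by (simp add: case_prod_unfold mult.commute)
qed

lemma linearization_phi: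
  fixes P P' \<tau>' G :: "real \<Rightarrow> real"
  assumes "isCont P t" "isCont P' t" "isCont \<tau>' t"
    and G: "isCont G t" and Rn: "isCont (\<lambda>(\<theta>, v, w). Rn \<theta> v w) (t, 0, 0)"
  shows "((\<lambda>(\<theta>, v, w, a :: real, b). P \<theta> * b + P' \<theta> * (v * w) + \<tau>' \<theta> * v + Rn \<theta> v w * G \<theta> * w)
      has_derivative (\<lambda>(x, v, w, a, b). P t * b + \<tau>' t * v + Rn t 0 0 * G t * w))
      (at (t, 0, 0, 0, 0))"
proof -
  note mult = has_derivative_mult_zero[where p = "(t, 0, 0, 0, 0) :: real \<times> real \<times> real \<times> real \<times> real"]
  have "((\<lambda>p. P (fst p) * snd (snd (snd (snd p))) + P' (fst p) * (fst (snd p) * fst (snd (snd p)))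
        + \<tau>' (fst p) * fst (snd p)
        + Rn (fst p) (fst (snd p)) (fst (snd (snd p))) * G (fst p) * fst (snd (snd p)))
      has_derivative (\<lambda>h. P t * snd (snd (snd (snd h))) + P' t * 0
        + \<tau>' t * fst (snd h) + Rn t 0 0 * G t * fst (snd (snd h))))
      (at (t, 0, 0, 0 :: real, 0))"
    using assms
    by (intro has_derivative_add
        mult[where f = "\<lambda>p. P (fst p)", simplified]
        mult[where f = "\<lambda>p. P' (fst p)", simplified fst_conv]
        mult[where f = "\<lambda>p. \<tau>' (fst p)", simplified fst_conv]
        mult[where f = "\<lambda>p. Rn (fst p) (fst (snd p)) (fst (snd (snd p))) * G (fst p)", simplified fst_conv snd_conv]
        continuous_intros isCont_of_fst isCont_of_first_three)
      (auto intro!: derivative_eq_intros)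
  then show ?thesis by (simp add: case_prod_unfold mult.commute)
qed

section \<open>The coefficient functions of the tippe top and their derivatives\<close>

locale tippe_top =
  fixes m g A C R \<epsilon> J :: real
  assumes pos: "m > 0" "g > 0" "A > 0" "C > 0" "R > 0" "0 < \<epsilon>" "\<epsilon> < R"
begin

abbreviation "D \<equiv> tt_D A C R \<epsilon>"
abbreviation "T \<equiv> tt_T_theta m A \<epsilon>"
abbreviation "P \<equiv> tt_T_phi A C R \<epsilon>"
abbreviation "\<tau> \<equiv> tt_tau A C R \<epsilon> J"
abbreviation "W \<equiv> tt_W m g A C R \<epsilon> J"

text \<open>The derivatives of \<open>D\<close> and of \<open>\<tau>\<close> are multiples of \<open>sin \<theta>\<close>; \<open>D_cofactor\<close> and \<open>tau_cofactor\<close>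
  are the quotients.\<close>

definition "D_cofactor x = 2 * (R^2 * (A - C) * cos x + C * R * \<epsilon>)"

definition "tau_cofactor x =
  J / (R^2 + \<epsilon>^2) *
  (((2 * R * \<epsilon> * A * cos x - C * (2 * R * \<epsilon> * cos x - \<epsilon>^2 + R^2)) * D x
     - (R * \<epsilon> * A * (sin x)^2 + C * (R + \<epsilon> * cos x) * (R * cos x - \<epsilon>)) * D_cofactor x) / (D x)^2)"

definition "T' x = 2 * \<epsilon>^2 * m * sin x * cos x"
definition "P' x = A * C * (2 * sin x * cos x * D x - (sin x)^2 * (sin x * D_cofactor x)) / (D x)^2"
text \<open>The factor \<open>sin x\<close> shows that both poles are relative equilibria for every
  \<open>J\<close>; the other equilibria are the zeros of the bracket.\<close>

definition "W' x = sin x * (m * g * \<epsilon> - J^2 * D_cofactor x / (2 * (D x)^2))"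
definition "W'' x =
  cos x * (m * g * \<epsilon> - J^2 * D_cofactor x / (2 * (D x)^2))
  + (sin x)^2 * (J^2 * (R^2 * (A - C) * D x + (D_cofactor x)^2) / (D x)^3)"

text \<open>At a pole the second summand of \<open>D\<close> is C times the square of R - \<epsilon>
  or of R + \<epsilon>, nonzero since 0 < \<epsilon> < R. Elsewhere the first summand is
  positive.\<close>

lemma D_pos: "D x > 0"
proof (cases "sin x = 0")
  case True
  then have "(cos x)^2 = 1" using sin_cos_squared_add[of x] by simp
  then have "cos x = 1 \<or> cos x = -1" by (simp add: power2_eq_1_iff)
  then have "R * cos x - \<epsilon> \<noteq> 0" using pos by auto
  then show ?thesis using pos True by (simp add: tt_D_def)
next
  case False
  then show ?thesis unfolding tt_D_def
    using pos by (intro add_pos_nonneg mult_nonneg_nonneg mult_pos_pos zero_less_power2[THEN iffD2]) auto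
qed

lemma D_nz: "D x \<noteq> 0"
  using D_pos[of x] by simp

lemma T_pos: "T x > 0"
  unfolding tt_T_theta_def using pos by (intro add_nonneg_pos) auto

lemma P_eq: "P x = A * C * (sin x)^2 / D x"
  by (simp add: tt_T_phi_def)

lemma DERIV_D: "(D has_real_derivative sin x * D_cofactor x) (at x)"
  unfolding tt_D_def D_cofactor_def
  by (auto intro!: derivative_eq_intros simp: algebra_simps power2_eq_square)

lemma DERIV_D_cofactor: "(D_cofactor has_real_derivative - 2 * R^2 * (A - C) * sin x) (at x)"
  unfolding D_cofactor_def by (auto intro!: derivative_eq_intros)

lemmas isCont_D [continuous_intros] = DERIV_isCont[OF DERIV_D]
  and isCont_D_cofactor [continuous_intros] = DERIV_isCont[OF DERIV_D_cofactor]

lemma DERIV_T: "(T has_real_derivative T' x) (at x)"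
  unfolding tt_T_theta_def T'_def by (auto intro!: derivative_eq_intros)

lemma DERIV_P: "(P has_real_derivative P' x) (at x)"
  unfolding tt_T_phi_def P'_def
  by (rule derivative_eq_intros DERIV_D refl D_nz)+
    (simp add: D_nz field_simps power2_eq_square)

text \<open>Numerator and denominator of \<open>\<tau>\<close> are polynomials in
  \<open>cos x\<close>, so both derivatives contain \<open>sin x\<close> and the quotient rule
  preserves this factor. Its square later cancels the zero of \<open>P\<close> at the poles.\<close>

lemma DERIV_tau: "(\<tau> has_real_derivative sin x * tau_cofactor x) (at x)"
proof -
  define N where "N x = R * \<epsilon> * A * (sin x)^2 + C * (R + \<epsilon> * cos x) * (R * cos x - \<epsilon>)" for x
  define M where "M x = 2 * R * \<epsilon> * A * cos x - C * (2 * R * \<epsilon> * cos x - \<epsilon>^2 + R^2)" for x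
  have N: "(N has_real_derivative sin x * M x) (at x)"
    unfolding N_def M_def
    by (auto intro!: derivative_eq_intros simp: algebra_simps power2_eq_square)
  have "((\<lambda>x. J / (R^2 + \<epsilon>^2) * (N x / D x)) has_real_derivative
      J / (R^2 + \<epsilon>^2) * ((sin x * M x * D x - N x * (sin x * D_cofactor x)) / (D x * D x))) (at x)"
    by (intro DERIV_cmult DERIV_divide N DERIV_D D_nz)
  moreover have "\<tau> = (\<lambda>x. J / (R^2 + \<epsilon>^2) * (N x / D x))"
    by (simp add: fun_eq_iff tt_tau_def N_def)
  moreover have "J / (R^2 + \<epsilon>^2) * ((sin x * M x * D x - N x * (sin x * D_cofactor x)) / (D x * D x))
      = sin x * tau_cofactor x"
    unfolding tau_cofactor_def M_def[symmetric] N_def[symmetric]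
    by (simp add: algebra_simps power2_eq_square diff_divide_distrib)
  ultimately show ?thesis by metis
qed

lemma DERIV_W: "(W has_real_derivative W' x) (at x)"
  unfolding tt_W_def W'_def
  by (rule derivative_eq_intros DERIV_D refl | simp add: D_nz)+
    (simp add: D_nz field_simps power2_eq_square)

lemma DERIV_W': "(W' has_real_derivative W'' x) (at x)"
  unfolding W'_def W''_def
  by (rule derivative_eq_intros DERIV_D DERIV_D_cofactor refl | simp add: D_nz)+
    (simp add: D_nz field_simps power2_eq_square power3_eq_cube power4_eq_xxxx)

lemma deriv_eqs:
  "deriv \<tau> = (\<lambda>x. sin x * tau_cofactor x)" "deriv W = W'" "deriv W' = W''"
proof -
  show "deriv \<tau> = (\<lambda>x. sin x * tau_cofactor x)"
    by (rule ext, rule DERIV_imp_deriv, rule DERIV_tau)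
  show "deriv W = W'"
    by (rule ext, rule DERIV_imp_deriv, rule DERIV_W)
  show "deriv W' = W''"
    by (rule ext, rule DERIV_imp_deriv, rule DERIV_W')
qed

lemma isCont_tau_cofactor [continuous_intros]: "isCont tau_cofactor x"
  unfolding tau_cofactor_def using pos
  by (intro continuous_intros) (auto simp: D_nz add_pos_pos less_imp_neq[THEN not_sym])

lemma isCont_W'' [continuous_intros]: "isCont W'' x"
  unfolding W''_def by (intro continuous_intros) (auto simp: D_nz)

lemma isCont_T' [continuous_intros]: "isCont T' x"
  unfolding T'_def by (intro continuous_intros)

lemma isCont_P' [continuous_intros]: "isCont P' x"
  unfolding P'_def by (intro continuous_intros) (auto simp: D_nz)

section \<open>Linearization of the reduced equations\<close>

lemma lagrangian_eq:
  "tt_lagrangian m g A C R \<epsilon> J = (\<lambda>\<theta> v w. 1/2 * T \<theta> * v^2 + 1/2 * P \<theta> * w^2 + \<tau> \<theta> * w - W \<theta>)"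
  by (simp add: fun_eq_iff tt_lagrangian_def)

lemma linearize_theta:
  assumes eq: "deriv W t = 0" "Rn t 0 0 = m * g"
    and Rn: "isCont (\<lambda>(\<theta>, v, w). Rn \<theta> v w) (t, 0, 0)"
  shows "((\<lambda>(\<theta>, v, w, a, b). tt_reduced_theta m g A C R \<epsilon> \<mu> J Rn \<theta> v w a b) has_derivative
      (\<lambda>(x, v, w, a, b). tt_linear_theta m g A C R \<epsilon> \<mu> J t x v w a)) (at (t, 0, 0, 0, 0))"
proof -
  \<comment> \<open>The geometric part of the friction, with \<open>\<mu>\<close>, takes the role of
    \<open>G\<close>; the reaction remains a separate factor until its equilibrium value
    \<open>m * g\<close> is inserted in \<open>lin\<close>.\<close>
  have deriv: "((\<lambda>(\<theta>, v, w, a, b :: real). T \<theta> * a + 1/2 * T' \<theta> * v^2 - 1/2 * P' \<theta> * w^2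
        - (sin \<theta> * tau_cofactor \<theta>) * w + W' \<theta> + Rn \<theta> v w * (\<mu> * (R - \<epsilon> * cos \<theta>)^2) * v)
      has_derivative (\<lambda>(x, v, w, a, b). T t * a - (sin t * tau_cofactor t) * w + W'' t * x
        + Rn t 0 0 * (\<mu> * (R - \<epsilon> * cos t)^2) * v)) (at (t, 0, 0, 0, 0))"
    by (rule linearization_theta) (intro DERIV_isCont[OF DERIV_T] DERIV_W' Rn continuous_intros)+
  have red: "(\<lambda>(\<theta>, v, w, a, b :: real). T \<theta> * a + 1/2 * T' \<theta> * v^2 - 1/2 * P' \<theta> * w^2
        - (sin \<theta> * tau_cofactor \<theta>) * w + W' \<theta> + Rn \<theta> v w * (\<mu> * (R - \<epsilon> * cos \<theta>)^2) * v)
      = (\<lambda>(\<theta>, v, w, a, b). tt_reduced_theta m g A C R \<epsilon> \<mu> J Rn \<theta> v w a b)"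
    unfolding tt_reduced_theta_def lagrangian_eq EL_quadratic[OF DERIV_T DERIV_P DERIV_tau DERIV_W]
    by (simp add: fun_eq_iff)
  have lin: "(\<lambda>(x, v, w, a, b :: real). T t * a - (sin t * tau_cofactor t) * w + W'' t * x
        + Rn t 0 0 * (\<mu> * (R - \<epsilon> * cos t)^2) * v)
      = (\<lambda>(x, v, w, a, b). tt_linear_theta m g A C R \<epsilon> \<mu> J t x v w a)"
    unfolding tt_linear_theta_def deriv_eqs eq by (simp add: fun_eq_iff algebra_simps)
  show ?thesis using deriv unfolding red lin .
qed

lemma linearize_phi:
  assumes eq: "Rn t 0 0 = m * g"
    and Rn: "isCont (\<lambda>(\<theta>, v, w). Rn \<theta> v w) (t, 0, 0)"
  shows "((\<lambda>(\<theta>, v, w, a, b). tt_reduced_phi m g A C R \<epsilon> \<mu> J Rn \<theta> v w a b) has_derivative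
      (\<lambda>(x, v, w, a, b). tt_linear_phi m g A C R \<epsilon> \<mu> J t v w b)) (at (t, 0, 0, 0, 0))"
proof -
  have deriv: "((\<lambda>(\<theta>, v, w, a :: real, b). P \<theta> * b + P' \<theta> * (v * w) + (sin \<theta> * tau_cofactor \<theta>) * v
        + Rn \<theta> v w * (\<mu> * (sin \<theta>)^2) * w)
      has_derivative (\<lambda>(x, v, w, a, b). P t * b + (sin t * tau_cofactor t) * v
        + Rn t 0 0 * (\<mu> * (sin t)^2) * w)) (at (t, 0, 0, 0, 0))"
    by (rule linearization_phi) (intro DERIV_isCont[OF DERIV_P] Rn continuous_intros)+
  have red: "(\<lambda>(\<theta>, v, w, a :: real, b). P \<theta> * b + P' \<theta> * (v * w) + (sin \<theta> * tau_cofactor \<theta>) * v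
        + Rn \<theta> v w * (\<mu> * (sin \<theta>)^2) * w)
      = (\<lambda>(\<theta>, v, w, a, b). tt_reduced_phi m g A C R \<epsilon> \<mu> J Rn \<theta> v w a b)"
    unfolding tt_reduced_phi_def lagrangian_eq EL_quadratic[OF DERIV_T DERIV_P DERIV_tau DERIV_W]
    by (simp add: fun_eq_iff)
  have lin: "(\<lambda>(x, v, w, a :: real, b). P t * b + (sin t * tau_cofactor t) * v
        + Rn t 0 0 * (\<mu> * (sin t)^2) * w)
      = (\<lambda>(x, v, w, a, b). tt_linear_phi m g A C R \<epsilon> \<mu> J t v w b)"
    unfolding tt_linear_phi_def deriv_eqs eq by (simp add: fun_eq_iff algebra_simps)
  show ?thesis using deriv unfolding red lin .
qed

section \<open>Extended coefficients and stability\<close>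

text \<open>These are the coefficients of \<open>q\<close> after inserting \<open>P\<close> and
  cancelling \<open>(sin x)^2\<close>, so that 1 / (A C / D) replaces
  \<open>(sin x)^2 / P x\<close>. No denominator vanishes at the poles.\<close>

definition "ext_c2 \<mu> x = \<mu> * m * g * ((R - \<epsilon> * cos x)^2 / T x + D x / (A * C))"
definition "ext_c1 \<mu> x =
  ((\<mu> * m * g * (R - \<epsilon> * cos x))^2 + (tau_cofactor x)^2) * D x / (T x * (A * C)) + W'' x / T x"
definition "ext_c0 \<mu> x = \<mu> * m * g * W'' x * D x / (T x * (A * C))"

lemma isCont_ext: "isCont (ext_c2 \<mu>) x" "isCont (ext_c1 \<mu>) x" "isCont (ext_c0 \<mu>) x"
  unfolding ext_c2_def ext_c1_def ext_c0_def using pos T_pos[of x]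
  by (intro continuous_intros DERIV_isCont[OF DERIV_T]; simp)+

lemma ext_eq:
  assumes "sin x \<noteq> 0"
  shows "tt_c2 m g A C R \<epsilon> \<mu> x = ext_c2 \<mu> x" "tt_c1 m g A C R \<epsilon> \<mu> J x = ext_c1 \<mu> x"
    "tt_c0 m g A C R \<epsilon> \<mu> J x = ext_c0 \<mu> x"
  using assms pos T_pos[of x] D_pos[of x]
  unfolding tt_c2_def tt_c1_def tt_c0_def ext_c2_def ext_c1_def ext_c0_def deriv_eqs P_eq
  by (simp_all add: field_simps power2_eq_square)

lemmas pole_ext_c2 = pole_ext_eq[OF isCont_ext(1) ext_eq(1)]
  and pole_ext_c1 = pole_ext_eq[OF isCont_ext(2) ext_eq(2)]
  and pole_ext_c0 = pole_ext_eq[OF isCont_ext(3) ext_eq(3)]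

lemma tt_q_eq: "tt_q m g A C R \<epsilon> \<mu> J x = [:ext_c0 \<mu> x, ext_c1 \<mu> x, ext_c2 \<mu> x, 1:]"
  by (simp add: tt_q_def pole_ext_c2(1) pole_ext_c1(1) pole_ext_c0(1))

lemma char_poly_tt_matrix:
  assumes "sin x \<noteq> 0"
  shows "char_poly (tt_matrix m g A C R \<epsilon> \<mu> J x) = [:0, 1:] * tt_q m g A C R \<epsilon> \<mu> J x"
proof -
  have "P x \<noteq> 0" using assms pos D_pos[of x] by (simp add: P_eq)
  then show ?thesis using T_pos[of x]
    unfolding tt_matrix_def Let_def char_poly_4 tt_q_eq ext_eq[OF assms, symmetric]
      tt_c2_def tt_c1_def tt_c0_def
    by (simp add: field_simps power2_eq_square)
qed

text \<open>The filter \<open>at t\<close> excludes \<open>t\<close> itself, so the meaningless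
  matrix at a pole never enters: nearby the sine is nonzero and the characteristic polynomial is the
  one already computed.\<close>

lemma char_poly_tendsto:
  "((\<lambda>x. coeff (char_poly (tt_matrix m g A C R \<epsilon> \<mu> J x)) k)
      \<longlongrightarrow> coeff ([:0, 1:] * tt_q m g A C R \<epsilon> \<mu> J t) k) (at t)"
proof -
  have "((\<lambda>x. coeff ([:0, 1:] * tt_q m g A C R \<epsilon> \<mu> J x) k)
      \<longlongrightarrow> coeff ([:0, 1:] * tt_q m g A C R \<epsilon> \<mu> J t) k) (at t)"
    unfolding tt_q_eq using isCont_ext[where \<mu> = \<mu> and x = t]
    by (auto simp: isCont_def coeff_pCons split: nat.split)
  moreover have "\<forall>\<^sub>F x in at t. coeff ([:0, 1:] * tt_q m g A C R \<epsilon> \<mu> J x) k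
      = coeff (char_poly (tt_matrix m g A C R \<epsilon> \<mu> J x)) k"
    using eventually_sin_nonzero[of t] by eventually_elim (simp add: char_poly_tt_matrix)
  ultimately show ?thesis by (rule Lim_transform_eventually)
qed

lemma stable_iff:
  assumes "\<mu> > 0"
  shows "(\<forall>z::complex. poly (map_poly complex_of_real (tt_q m g A C R \<epsilon> \<mu> J x)) z = 0 \<longrightarrow> Re z < 0)
    \<longleftrightarrow> W'' x > 0"
proof
  assume stable: "\<forall>z::complex. poly (map_poly complex_of_real (tt_q m g A C R \<epsilon> \<mu> J x)) z = 0 \<longrightarrow> Re z < 0"
  show "W'' x > 0"
  proof (rule ccontr)
    assume "\<not> W'' x > 0"
    then have "ext_c0 \<mu> x \<le> 0"
      unfolding ext_c0_def using pos assms T_pos[of x] D_pos[of x]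
      by (intro divide_nonpos_pos mult_nonpos_nonneg mult_nonneg_nonpos) auto
    then obtain r where r: "r \<ge> 0" "poly (tt_q m g A C R \<epsilon> \<mu> J x) r = 0"
      unfolding tt_q_eq by (blast dest: cubic_nonneg_root)
    then have "poly (map_poly complex_of_real (tt_q m g A C R \<epsilon> \<mu> J x)) (complex_of_real r) = 0"
      by simp
    then have "Re (complex_of_real r) < 0" using stable by blast
    then show False using r(1) by simp
  qed
next
  assume W: "W'' x > 0"
  \<comment> \<open>\<open>d\<close> and \<open>e\<close> are the damping rates of
    \<open>\<theta>\<close> and \<open>\<phi>\<close>, and \<open>w\<close> is the stiffness in
    \<open>\<theta>\<close> per unit inertia. \<open>s\<close> is \<open>d * e\<close> plus the
    gyroscopic contribution of \<open>\<tau>'\<close>.\<close>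
  define d where "d = \<mu> * m * g * (R - \<epsilon> * cos x)^2 / T x"
  define e where "e = \<mu> * m * g * D x / (A * C)"
  define w where "w = W'' x / T x"
  define s where "s = ((\<mu> * m * g * (R - \<epsilon> * cos x))^2 + (tau_cofactor x)^2) * D x / (T x * (A * C))"
  \<comment> \<open>Strict positivity of \<open>R - \<epsilon> * cos x\<close> gives
    \<open>d > 0\<close>, and also \<open>s > 0\<close> even where \<open>tau_cofactor\<close>
    vanishes, for instance when \<open>J\<close> is 0.\<close>
  have "\<epsilon> * cos x \<le> \<epsilon> * 1" using pos by (intro mult_left_mono) auto
  then have "R - \<epsilon> * cos x > 0" using pos by linarith
  then have "d > 0" "e > 0" "w > 0" "s > 0"
    unfolding d_def e_def w_def s_def using pos assms W T_pos[of x] D_pos[of x]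
    by (auto intro!: divide_pos_pos mult_pos_pos add_pos_nonneg)
  moreover have "ext_c0 \<mu> x = e * w" "ext_c1 \<mu> x = s + w" "ext_c2 \<mu> x = d + e"
    by (simp_all add: ext_c0_def ext_c1_def ext_c2_def d_def e_def w_def s_def algebra_simps)
  moreover have "(d + e) * (s + w) = e * w + ((d + e) * s + d * w)"
    by (simp add: algebra_simps)
  ultimately have "ext_c0 \<mu> x > 0" "ext_c1 \<mu> x > 0" "ext_c2 \<mu> x > 0"
    "ext_c2 \<mu> x * ext_c1 \<mu> x > ext_c0 \<mu> x"
    by (simp_all add: add_pos_pos)
  then show "\<forall>z::complex. poly (map_poly complex_of_real (tt_q m g A C R \<epsilon> \<mu> J x)) z = 0 \<longrightarrow> Re z < 0"
    unfolding tt_q_eq by (intro allI impI routh_hurwitz_cubic)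
qed

end

theorem mainTheorem2:
  fixes m g A C R \<mu> \<epsilon> J \<theta>\<^sub>0 :: real
    and Rn :: "real \<Rightarrow> real \<Rightarrow> real \<Rightarrow> real"
  assumes "m > 0" "g > 0" "A > 0" "C > 0" "R > 0" "\<mu> > 0"
    and "0 < \<epsilon>" "\<epsilon> < R"
    and "\<theta>\<^sub>0 \<in> {0..pi}"
    and "deriv (tt_W m g A C R \<epsilon> J) \<theta>\<^sub>0 = 0"
    and Rn_equilibrium:
      "\<And>\<theta>. \<theta> \<in> {0..pi} \<Longrightarrow> deriv (tt_W m g A C R \<epsilon> J) \<theta> = 0 \<Longrightarrow> Rn \<theta> 0 0 = m * g"
    and Rn_continuous: "isCont (\<lambda>(\<theta>, v, w). Rn \<theta> v w) (\<theta>\<^sub>0, 0, 0)"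
  shows
    \<comment> \<open>\<open>tt_linear_theta\<close>, \<open>tt_linear_phi\<close> linearize the reduced equations at the equilibrium\<close>
    "((\<lambda>(\<theta>, v, w, a, b). tt_reduced_theta m g A C R \<epsilon> \<mu> J Rn \<theta> v w a b) has_derivative
      (\<lambda>(x, v, w, a, b). tt_linear_theta m g A C R \<epsilon> \<mu> J \<theta>\<^sub>0 x v w a)) (at (\<theta>\<^sub>0, 0, 0, 0, 0))
   \<and> ((\<lambda>(\<theta>, v, w, a, b). tt_reduced_phi m g A C R \<epsilon> \<mu> J Rn \<theta> v w a b) has_derivative
      (\<lambda>(x, v, w, a, b). tt_linear_phi m g A C R \<epsilon> \<mu> J \<theta>\<^sub>0 v w b)) (at (\<theta>\<^sub>0, 0, 0, 0, 0))
   \<comment> \<open>the continuous extensions of the coefficients exist\<close>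
   \<and> (tt_c2 m g A C R \<epsilon> \<mu> \<longlongrightarrow> pole_ext (tt_c2 m g A C R \<epsilon> \<mu>) \<theta>\<^sub>0) (at \<theta>\<^sub>0)
   \<and> (tt_c1 m g A C R \<epsilon> \<mu> J \<longlongrightarrow> pole_ext (tt_c1 m g A C R \<epsilon> \<mu> J) \<theta>\<^sub>0) (at \<theta>\<^sub>0)
   \<and> (tt_c0 m g A C R \<epsilon> \<mu> J \<longlongrightarrow> pole_ext (tt_c0 m g A C R \<epsilon> \<mu> J) \<theta>\<^sub>0) (at \<theta>\<^sub>0)
   \<comment> \<open>the characteristic polynomial; at the poles by continuous extension of its coefficients\<close>
   \<and> (sin \<theta>\<^sub>0 \<noteq> 0 \<longrightarrow>
        char_poly (tt_matrix m g A C R \<epsilon> \<mu> J \<theta>\<^sub>0) = [:0, 1:] * tt_q m g A C R \<epsilon> \<mu> J \<theta>\<^sub>0)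
   \<and> (sin \<theta>\<^sub>0 = 0 \<longrightarrow>
        (\<forall>k. ((\<lambda>\<theta>. coeff (char_poly (tt_matrix m g A C R \<epsilon> \<mu> J \<theta>)) k)
               \<longlongrightarrow> coeff ([:0, 1:] * tt_q m g A C R \<epsilon> \<mu> J \<theta>\<^sub>0) k) (at \<theta>\<^sub>0)))
   \<and> ((\<forall>z::complex. poly (map_poly complex_of_real (tt_q m g A C R \<epsilon> \<mu> J \<theta>\<^sub>0)) z = 0 \<longrightarrow> Re z < 0)
      \<longleftrightarrow> deriv (deriv (tt_W m g A C R \<epsilon> J)) \<theta>\<^sub>0 > 0)"
proof -
  interpret tippe_top m g A C R \<epsilon> J by unfold_locales fact+
  have Rn0: "Rn \<theta>\<^sub>0 0 0 = m * g"
    using assms(9,10) by (rule Rn_equilibrium)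
  have stable: "(\<forall>z::complex. poly (map_poly complex_of_real (tt_q m g A C R \<epsilon> \<mu> J \<theta>\<^sub>0)) z = 0 \<longrightarrow> Re z < 0)
      \<longleftrightarrow> deriv (deriv (tt_W m g A C R \<epsilon> J)) \<theta>\<^sub>0 > 0"
    unfolding deriv_eqs by (rule stable_iff) fact
  show ?thesis
    by (intro conjI impI allI linearize_theta linearize_phi assms(10) Rn0 Rn_continuous
        pole_ext_c2(2) pole_ext_c1(2) pole_ext_c0(2) char_poly_tt_matrix char_poly_tendsto stable)
qed

end
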